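(* For every integer $n\geq 9$, the $2$-extra connectivity of the $n$-dimensional augmented cube satisfies $\kappa_2(AQ_n)=6n-17$.
   Context: The $n$-dimensional augmented cube $AQ_n$ has vertex set $\{0,1\}^n$, vertices written as strings $X=x_nx_{n-1}\cdots x_1$. For $1\le i\le n$ let $X_i=x_n\cdots x_{i+1}\bar x_i x_{i-1}\cdots x_1$ (flip bit $i$) and $\overline{X}_i=x_n\cdots x_{i+1}\bar x_i\bar x_{i-1}\cdots\bar x_1$ (flip bits $i,i-1,\dots,1$), where $\bar x=1-x$. Two distinct vertices $X,Y$ are adjacent iff $Y=X_i$ for some $1\le i\le n$ or $Y=\overline{X}_i$ for some $2\le i\le n$. (Equivalently, $AQ_1=K_2$ and $AQ_n$ is obtained from two copies of $AQ_{n-1}$, with prefixes $0$ and $1$, by joining $0x_{n-1}\cdots x_1$ to $1y_{n-1}\cdots y_1$ iff $y_i=x_i$ for all $i$ or $y_i=\bar x_i$ for all $i$.) For a graph $G$ and integer $h\ge0$, a vertex set $S\subseteq V(G)$ is an $h$-vertex-cut if $G-S$ is disconnected and every component of $G-S$ has more than $h$ vertices; the $h$-extra connectivity $\kappa_h(G)$ is the minimum cardinality of an $h$-vertex-cut of $G$. *)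

theory Defs
  imports Main
begin

definition reach_in :: "('a \<Rightarrow> 'a \<Rightarrow> bool) \<Rightarrow> 'a set \<Rightarrow> 'a \<Rightarrow> 'a \<Rightarrow> bool" where
  "reach_in E W x y \<longleftrightarrow> x \<in> W \<and> y \<in> W \<and> (\<lambda>u v. u \<in> W \<and> v \<in> W \<and> E u v)\<^sup>*\<^sup>* x y"

definition components_in :: "('a \<Rightarrow> 'a \<Rightarrow> bool) \<Rightarrow> 'a set \<Rightarrow> 'a set set" where
  "components_in E W = {{y. reach_in E W x y} | x. x \<in> W}"

definition h_vertex_cut :: "'a set \<Rightarrow> ('a \<Rightarrow> 'a \<Rightarrow> bool) \<Rightarrow> nat \<Rightarrow> 'a set \<Rightarrow> bool" where
  "h_vertex_cut V E h S \<longleftrightarrow> S \<subseteq> V \<and>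
     (\<exists>x\<in>V - S. \<exists>y\<in>V - S. \<not> reach_in E (V - S) x y) \<and>
     (\<forall>C\<in>components_in E (V - S). card C > h)"

definition extra_connectivity :: "'a set \<Rightarrow> ('a \<Rightarrow> 'a \<Rightarrow> bool) \<Rightarrow> nat \<Rightarrow> nat" where
  "extra_connectivity V E h = (LEAST k. \<exists>S. h_vertex_cut V E h S \<and> card S = k)"

(* Augmented cube AQ_n. A vertex x_n...x_1 in {0,1}^n is encoded as the set
   of positions i in {1..n} with x_i = 1. Flipping bit i is symmetric
   difference with {i}; flipping bits i,i-1,...,1 is symmetric difference
   with {1..i}. *)
definition aq_verts :: "nat \<Rightarrow> nat set set" where
  "aq_verts n = Pow {1..n}"

definition aq_adj :: "nat \<Rightarrow> nat set \<Rightarrow> nat set \<Rightarrow> bool" where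
  "aq_adj n X Y \<longleftrightarrow> X \<in> aq_verts n \<and> Y \<in> aq_verts n \<and> X \<noteq> Y \<and>
     ((\<exists>i\<in>{1..n}. Y = (X - {i}) \<union> ({i} - X)) \<or>
      (\<exists>i\<in>{2..n}. Y = (X - {1..i}) \<union> ({1..i} - X)))"

end

theory Submission
  imports Defs
begin

text \<open>\<open>AQ\<^sub>n\<close> is the Cayley graph of \<open>(\<int>/2)\<^sup>n\<close>, under symmetric difference, on the singletons \<open>{i}\<close> and the
  prefixes \<open>{1..i}\<close>. Comparing maxima shows that a nonzero element is a sum of two generators in at most
  two ways, so two vertices have at most four common neighbours, and a set of \<open>m\<close> vertices
  has at least about \<open>2 * m * (n - m)\<close> boundary vertices; for \<open>m = 3\<close> a closer look gives \<open>6 * n - 17\<close>.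

  For the lower bound, suppose that deleting \<open>S\<close> separates \<open>A\<close> from \<open>B\<close>. Split \<open>AQ\<^sub>n\<close> into two
  copies of the augmented cube of dimension \<open>n - 1\<close>; in the one containing fewer vertices of \<open>S\<close>, one side, say \<open>A\<close>, is tiny by induction.
  In the other copy either \<open>S\<close> has lost enough vertices to use induction again, or \<open>A\<close> is bounded by
  the few cut vertices across the perfect matching. In both cases \<open>A\<close> is so
  small that the boundary estimates apply. The upper bound comes from the boundary of the path \<open>{1,2}, {}, {1,2,3,4}\<close>,
  whose vertices have 4, 4, 4 pairwise common neighbours.\<close>

subsection \<open>Generators\<close>

text \<open>Prefixes start at \<open>i = 1\<close>, unlike in \<open>aq_adj\<close>, so
  \<open>{1}\<close> is listed twice; in return every generator with maximum \<open>k\<close> is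
  \<open>{k}\<close> or \<open>{1..k}\<close>, without exception.\<close>

definition gens :: "nat \<Rightarrow> nat set set" where
  "gens n = (\<lambda>i. {i}) ` {1..n} \<union> (\<lambda>i. {1..i}) ` {1..n}"

definition nbrs :: "nat \<Rightarrow> nat set \<Rightarrow> nat set set" where
  "nbrs n X = {Y. aq_adj n X Y}"

lemma sym_diff_cancel [simp]: "sym_diff X (sym_diff X Y) = Y"
  by blast

lemma sym_diff_eq_iff: "sym_diff X Y = Z \<longleftrightarrow> Y = sym_diff X Z"
  by auto

lemma inj_sym_diff: "inj_on (sym_diff X) A"
  by (rule inj_on_inverseI[where g = "sym_diff X"]) (rule sym_diff_cancel)

lemma gens_mem: "g \<in> gens n \<longleftrightarrow> (\<exists>i\<in>{1..n}. g = {i} \<or> g = {1..i})"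
  by (auto simp: gens_def)

lemma gens_eq: "gens n = (\<lambda>i. {i}) ` {1..n} \<union> (\<lambda>i. {1..i}) ` {2..n}"
proof -
  have "{1..i} \<in> (\<lambda>i. {i}) ` {1..n} \<union> (\<lambda>i. {1..i}) ` {2..n}" if "i \<in> {1..n}" for i
    using that by (cases "i = 1") auto
  then show ?thesis
    unfolding gens_def by fastforce
qed

lemma card_gens:
  assumes "n \<ge> 1"
  shows "card (gens n) = 2 * n - 1"
proof -
  have "inj_on (\<lambda>i. {i}) {1..n}" by simp
  then have 1: "card ((\<lambda>i. {i}) ` {1..n}) = n" by (simp add: card_image)
  have "inj_on (\<lambda>i::nat. {1..i}) {2..n}"
    by (auto simp: inj_on_def)
  then have 2: "card ((\<lambda>i::nat. {1..i}) ` {2..n}) = n - 1" by (simp add: card_image)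
  have "{i} \<noteq> {1..j}" if "j \<ge> 2" for i j :: nat
    using that by (metis One_nat_def Suc_1 Suc_leD atLeastAtMost_iff le_refl n_not_Suc_n singletonD)
  then have "(\<lambda>i. {i}) ` {1..n} \<inter> (\<lambda>i. {1..i}) ` {2..n} = {}"
    by fastforce
  then have "card (gens n) = n + (n - 1)"
    unfolding gens_eq using 1 2 by (subst card_Un_disjoint) auto
  also have "\<dots> = 2 * n - 1" using assms by simp
  finally show ?thesis .
qed

lemma aq_adj_iff: "aq_adj n X Y \<longleftrightarrow> X \<in> aq_verts n \<and> (\<exists>g\<in>gens n. Y = sym_diff X g)"
proof -
  have "sym_diff X g \<in> aq_verts n \<and> sym_diff X g \<noteq> X" if "g \<in> gens n" "X \<in> aq_verts n" for g
  proof -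
    have "g \<subseteq> {1..n}" "g \<noteq> {}" using that(1) by (auto simp: gens_mem)
    then show ?thesis using that(2) by (auto simp: aq_verts_def)
  qed
  then show ?thesis
    unfolding aq_adj_def gens_eq by blast
qed

lemma aq_adjI: "X \<in> aq_verts n \<Longrightarrow> g \<in> gens n \<Longrightarrow> aq_adj n X (sym_diff X g)"
  unfolding aq_adj_iff by blast

lemma nbrs_iff: "Y \<in> nbrs n X \<longleftrightarrow> X \<in> aq_verts n \<and> sym_diff X Y \<in> gens n"
proof -
  have "Y = sym_diff X g \<longleftrightarrow> g = sym_diff X Y" for g by blast
  then show ?thesis unfolding nbrs_def aq_adj_iff by simp
qed

lemma nbrs_eq: "X \<in> aq_verts n \<Longrightarrow> nbrs n X = sym_diff X ` gens n"
  by (auto simp: nbrs_def aq_adj_iff)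

lemma aq_adj_sym: "aq_adj n X Y \<Longrightarrow> aq_adj n Y X"
  unfolding aq_adj_def by (elim conjE disjE bexE) (auto 0 4)

lemma nbrs_subset: "nbrs n X \<subseteq> aq_verts n"
  by (auto simp: nbrs_def aq_adj_def)

lemma finite_aq_verts [simp]: "finite (aq_verts n)"
  by (simp add: aq_verts_def)

lemma finite_nbrs [simp]: "finite (nbrs n X)"
  by (rule finite_subset[OF nbrs_subset]) simp

lemma card_nbrs:
  assumes "n \<ge> 1" "X \<in> aq_verts n"
  shows "card (nbrs n X) = 2 * n - 1"
  unfolding nbrs_eq[OF assms(2)] card_image[OF inj_sym_diff] by (rule card_gens[OF assms(1)])

section \<open>Sums of two generators\<close>

lemma Max_atLeastAtMost_nat [simp]: "i \<le> j \<Longrightarrow> Max {i..j} = (j :: nat)"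
  by (intro Max_eqI) auto

lemma Max_sym_diff_less:
  fixes g h :: "nat set"
  assumes "finite g" "finite h" "h \<noteq> {}" "\<And>x. x \<in> g \<Longrightarrow> x < Max h"
  shows "Max (sym_diff g h) = Max h"
proof (rule Max_eqI)
  show "finite (sym_diff g h)" using assms by simp
  have "Max h \<in> h" using assms by simp
  then show "Max h \<in> sym_diff g h" using assms(4) by blast
  show "y \<le> Max h" if "y \<in> sym_diff g h" for y
    using that assms by (metis DiffD1 Max_ge UnE less_imp_le)
qed

lemma gens_Max: "g \<in> gens n \<Longrightarrow> \<exists>k. 1 \<le> k \<and> k \<le> n \<and> Max g = k \<and> (g = {k} \<or> g = {1..k})"
  by (auto simp: gens_mem)

text \<open>Two generators adding up to \<open>d\<close> either have equal maxima \<open>k\<close>, and then are \<open>{k}\<close> and \<open>{1..k}\<close>,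
  or the larger of their maxima is \<open>Max d\<close>.\<close>

lemma gens_decompose:
  assumes d: "d \<noteq> {}" and g: "g \<in> gens n" and h: "h \<in> gens n" and dgh: "d = sym_diff g h"
  defines "m \<equiv> Max d"
  shows "g \<in> {{m}, {1..m}} \<or> h \<in> {{m}, {1..m}} \<or> (d = {1..m} \<and> g \<in> {{Suc m}, {1..Suc m}})"
proof -
  obtain k where k: "k \<ge> 1" "Max g = k" "g = {k} \<or> g = {1..k}" using gens_Max[OF g] by auto
  obtain l where l: "l \<ge> 1" "Max h = l" "h = {l} \<or> h = {1..l}" using gens_Max[OF h] by auto
  have fin: "finite g" "finite h" using k(3) l(3) by auto
  have ne: "g \<noteq> {}" "h \<noteq> {}" using k(1,3) l(1,3) by auto
  have g_le: "x \<le> k" if "x \<in> g" for x using that k(3) by auto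
  have h_le: "x \<le> l" if "x \<in> h" for x using that l(3) by auto
  consider "k = l" | "k < l" | "l < k" by linarith
  then show ?thesis
  proof cases
    case 1
    have "g \<noteq> h" using d dgh by blast
    then have "g = {k} \<and> h = {1..k} \<or> g = {1..k} \<and> h = {k}"
      using k(3) l(3) 1 by blast
    then have "d = {1..k} - {k}" unfolding dgh using k(1) by (elim disjE conjE) auto
    then have *: "d = {1..k - 1}" using k(1) by auto
    then have "k - 1 \<ge> 1" using d by auto
    then have m: "m = k - 1" unfolding m_def * by simp
    then have "Suc m = k" using k(1) by simp
    then show ?thesis using k(3) * m by auto
  next
    case 2
    have "x < l" if "x \<in> g" for x using g_le[OF that] 2 by simp
    then have "m = l"
      unfolding m_def dgh using Max_sym_diff_less[OF fin ne(2)] l(2) by simp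
    then show ?thesis using l(3) by blast
  next
    case 3
    have "x < k" if "x \<in> h" for x using h_le[OF that] 3 by simp
    then have "Max (sym_diff h g) = k"
      using Max_sym_diff_less[OF fin(2,1) ne(1)] k(2) by simp
    moreover have "d = sym_diff h g" using dgh by blast
    ultimately have "m = k" unfolding m_def by simp
    then show ?thesis using k(3) by blast
  qed
qed

text \<open>The representations of \<open>d\<close> as a sum of two generators, recorded by one
  summand, so that the sum of two different generators counts twice. Translated by \<open>X\<close>,
  they are the common neighbours of \<open>X\<close> and \<open>sym_diff X d\<close>.\<close>

definition split_gens :: "nat \<Rightarrow> nat set \<Rightarrow> nat set set" where
  "split_gens n d = {g \<in> gens n. sym_diff d g \<in> gens n}"

text \<open>If \<open>d\<close> is not a prefix, one summand is \<open>{m}\<close> or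
  \<open>{1..m}\<close>, which gives two choices and their two partners. If
  \<open>d = {1..m}\<close>, then \<open>{Suc m}\<close> and \<open>{1..Suc m}\<close> join the
  list, but \<open>{1..m}\<close> drops out together with its partner \<open>{}\<close>.\<close>

lemma card_split_gens_le:
  assumes "d \<noteq> {}"
  shows "card (split_gens n d) \<le> 4"
proof -
  define m where "m = Max d"
  have nonempty: "{} \<notin> gens n" by (auto simp: gens_mem)
  have sub: "split_gens n d \<subseteq> {{m}, {1..m}, sym_diff d {m}, sym_diff d {1..m}} \<union>
      (if d = {1..m} then {{Suc m}, {1..Suc m}} else {})"
  proof
    fix g assume "g \<in> split_gens n d"
    then have *: "g \<in> gens n" "sym_diff d g \<in> gens n" by (auto simp: split_gens_def)
    have "d = sym_diff g (sym_diff d g)" by blast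
    from gens_decompose[OF assms * this] show "g \<in> {{m}, {1..m}, sym_diff d {m}, sym_diff d {1..m}} \<union>
      (if d = {1..m} then {{Suc m}, {1..Suc m}} else {})"
      unfolding m_def[symmetric] by (auto simp: sym_diff_eq_iff)
  qed
  show ?thesis
  proof (cases "d = {1..m}")
    case False
    then have "card (split_gens n d) \<le> card {{m}, {1..m}, sym_diff d {m}, sym_diff d {1..m}}"
      using sub by (intro card_mono) auto
    also have "\<dots> \<le> 4" by (auto simp: card_insert_if)
    finally show ?thesis .
  next
    case True
    have "d \<notin> split_gens n d" using nonempty by (auto simp: split_gens_def)
    moreover have "sym_diff d {1..m} \<notin> split_gens n d" using True nonempty by (auto simp: split_gens_def)
    ultimately have "split_gens n d \<subseteq> {{m}, sym_diff d {m}, {Suc m}, {1..Suc m}}"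
      using sub True by auto
    then have "card (split_gens n d) \<le> card {{m}, sym_diff d {m}, {Suc m}, {1..Suc m}}"
      by (intro card_mono) auto
    also have "\<dots> \<le> 4" by (auto simp: card_insert_if)
    finally show ?thesis .
  qed
qed

lemma atLeastAtMost_mem_gens:
  assumes "2 \<le> i" "i < j"
  shows "{i..j} \<notin> gens n"
proof
  assume "{i..j} \<in> gens n"
  then obtain k where "{i..j} = {k} \<or> {i..j} = {1..k}" by (auto simp: gens_mem)
  moreover have "i \<in> {i..j}" "j \<in> {i..j}" "1 \<notin> {i..j}" using assms by auto
  ultimately show False using assms by (metis Suc_1 atLeastAtMost_iff
     le_refl nat_less_le order_trans singletonD Suc_leD One_nat_def)
qed

text \<open>Splitting off \<open>{j}\<close> leaves \<open>{i..j - 1}\<close>, which is empty or has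
  at least two elements without being a prefix; the excluded case \<open>j = Suc i\<close> would
  leave the singleton \<open>{i}\<close>. So the summands can only be \<open>{1..j}\<close> and
  \<open>{1..i - 1}\<close>.\<close>

lemma card_split_gens_interval:
  assumes "2 \<le> i" "i \<le> j" "j \<noteq> Suc i"
  shows "card (split_gens n {i..j}) \<le> 2"
proof -
  have Max: "Max {i..j} = j" using assms by simp
  have ne: "{i..j} \<noteq> {1..j}" "{i..j} \<noteq> {}" using assms
    by (metis Suc_1 atLeastAtMost_iff le_refl not_less_eq_eq order_trans One_nat_def, use assms in auto)
  have ej: "sym_diff {i..j} {j} \<notin> gens n"
  proof (cases "i = j")
    case True
    then show ?thesis by (auto simp: gens_mem)
  next
    case False
    have "sym_diff {i..j} {j} = {i..j - 1}" using assms False by auto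
    then show ?thesis using atLeastAtMost_mem_gens[of i "j - 1"] assms False by simp
  qed
  have "split_gens n {i..j} \<subseteq> {{1..j}, sym_diff {i..j} {1..j}}"
  proof
    fix g assume "g \<in> split_gens n {i..j}"
    then have *: "g \<in> gens n" "sym_diff {i..j} g \<in> gens n" by (auto simp: split_gens_def)
    have "{i..j} = sym_diff g (sym_diff {i..j} g)" by blast
    from gens_decompose[OF ne(2) * this]
    have "g \<in> {{j}, {1..j}} \<or> sym_diff {i..j} g \<in> {{j}, {1..j}}"
      unfolding Max using ne by blast
    moreover have "g \<noteq> {j}" using ej * by metis
    moreover have "sym_diff {i..j} g \<noteq> {j}"
      using ej *(1) by (metis sym_diff_cancel)
    ultimately show "g \<in> {{1..j}, sym_diff {i..j} {1..j}}"
      by (auto simp: sym_diff_eq_iff)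
  qed
  then have "card (split_gens n {i..j}) \<le> card {{1..j}, sym_diff {i..j} {1..j}}"
    by (intro card_mono) auto
  also have "\<dots> \<le> 2" by (auto simp: card_insert_if)
  finally show ?thesis .
qed

section \<open>Common neighbours\<close>

lemma common_nbrs_eq:
  assumes "X \<in> aq_verts n" "Y \<in> aq_verts n"
  shows "nbrs n X \<inter> nbrs n Y = sym_diff X ` split_gens n (sym_diff X Y)"
proof -
  have *: "sym_diff (sym_diff X Y) g = sym_diff Y (sym_diff X g)" for g by blast
  have "sym_diff X g \<in> sym_diff Y ` gens n \<longleftrightarrow> sym_diff Y (sym_diff X g) \<in> gens n" for g
    by (metis (no_types, lifting) image_iff sym_diff_cancel)
  then show ?thesis
    unfolding nbrs_eq[OF assms(1)] nbrs_eq[OF assms(2)] split_gens_def * by blast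
qed

lemma card_common_nbrs:
  assumes "X \<in> aq_verts n" "Y \<in> aq_verts n"
  shows "card (nbrs n X \<inter> nbrs n Y) = card (split_gens n (sym_diff X Y))"
  by (simp add: common_nbrs_eq assms card_image inj_sym_diff)

lemma card_common_nbrs_le:
  assumes "X \<in> aq_verts n" "Y \<in> aq_verts n" "X \<noteq> Y"
  shows "card (nbrs n X \<inter> nbrs n Y) \<le> 4"
proof -
  have "sym_diff X Y \<noteq> {}" using assms by blast
  then show ?thesis unfolding card_common_nbrs[OF assms(1,2)] by (rule card_split_gens_le)
qed


subsection \<open>Vertex boundaries of small sets\<close>

definition bdry :: "nat \<Rightarrow> nat set set \<Rightarrow> nat set set" where
  "bdry n A = (\<Union>X\<in>A. nbrs n X) - A"

lemma bdry_subset: "bdry n A \<subseteq> aq_verts n"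
  using nbrs_subset by (auto simp: bdry_def)

lemma finite_bdry [simp]: "finite (bdry n A)"
  by (rule finite_subset[OF bdry_subset]) simp

lemma aq_adj_irrefl: "\<not> aq_adj n X X"
  by (simp add: aq_adj_def)

text \<open>Bonferroni's inequality, as \<open>card A * (2 * n - 1) - 4 * (card A choose 2)\<close> bounds the union from below.\<close>

lemma card_UN_nbrs_ge:
  assumes "A \<subseteq> aq_verts n" "n \<ge> 1"
  shows "card A * (2 * n + 1) \<le> card (\<Union>X\<in>A. nbrs n X) + 2 * (card A)\<^sup>2"
proof -
  have "finite A" using finite_subset[OF assms(1)] by simp
  then show ?thesis using assms(1)
  proof (induction A)
    case empty
    then show ?case by simp
  next
    case (insert X A)
    let ?U = "\<Union>Y\<in>A. nbrs n Y"
    have "card (nbrs n X \<inter> ?U) \<le> (\<Sum>Y\<in>A. card (nbrs n X \<inter> nbrs n Y))"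
      unfolding Int_UN_distrib by (rule card_UN_le) (rule insert)
    also have "\<dots> \<le> (\<Sum>Y\<in>A. 4)"
      using insert by (intro sum_mono card_common_nbrs_le) auto
    finally have *: "card (nbrs n X \<inter> ?U) \<le> 4 * card A" by simp
    have "card (nbrs n X) + card ?U = card (nbrs n X \<union> ?U) + card (nbrs n X \<inter> ?U)"
      using insert by (intro card_Un_Int) auto
    moreover have "card (nbrs n X) = 2 * n - 1" using insert assms by (intro card_nbrs) auto
    ultimately have "2 * n - 1 + card ?U \<le> card (nbrs n X \<union> ?U) + 4 * card A"
      using * by linarith
    then show ?case
      using insert assms by (simp add: power2_eq_square algebra_simps)
  qed
qed

text \<open>A set and its boundary together form its closed neighbourhood, which grows with the
  set.\<close>

lemma card_bdry_mono:
  assumes "B \<subseteq> A" "A \<subseteq> aq_verts n"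
  shows "card (bdry n B) + card B \<le> card (bdry n A) + card A"
proof -
  have fin: "finite A" "finite B" using assms finite_subset by (metis finite_aq_verts)+
  have "card (bdry n B) + card B = card (bdry n B \<union> B)"
    using fin by (subst card_Un_disjoint) (auto simp: bdry_def)
  also have "\<dots> \<le> card (bdry n A \<union> A)"
    using fin assms by (intro card_mono) (auto simp: bdry_def)
  also have "\<dots> = card (bdry n A) + card A"
    using fin by (subst card_Un_disjoint) (auto simp: bdry_def)
  finally show ?thesis .
qed

lemma card_bdry_ge:
  assumes "A \<subseteq> aq_verts n" "n \<ge> 1"
  shows "card A * (2 * n) \<le> card (bdry n A) + 2 * (card A)\<^sup>2"
proof -
  have "card (\<Union>X\<in>A. nbrs n X) - card A \<le> card (bdry n A)"
    unfolding bdry_def using finite_subset[OF assms(1)] by (intro diff_card_le_card_Diff) auto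
  then show ?thesis using card_UN_nbrs_ge[OF assms] by (simp add: algebra_simps)
qed

text \<open>The quadratic loss in \<open>card_bdry_ge\<close> ruins the estimate for large sets; it
  is therefore applied to \<open>k\<close> of the vertices and carried over to all of
  \<open>A\<close> by monotonicity.\<close>

lemma card_bdry_ge_subset:
  assumes "A \<subseteq> aq_verts n" "n \<ge> 1" "k \<le> card A"
  shows "2 * n * k + k \<le> card (bdry n A) + card A + 2 * k\<^sup>2"
proof -
  obtain B where "B \<subseteq> A" "card B = k" using assms(3) by (meson obtain_subset_with_card_n)
  moreover from this have "B \<subseteq> aq_verts n" using assms(1) by blast
  ultimately show ?thesis
    using card_bdry_mono[of B A n] card_bdry_ge[of B n] assms(1,2) by (simp add: algebra_simps)
qed

lemma card_bdry_singleton: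
  assumes "X \<in> aq_verts n" "n \<ge> 1"
  shows "card (bdry n {X}) = 2 * n - 1"
proof -
  have "bdry n {X} = nbrs n X" by (auto simp: bdry_def nbrs_def aq_adj_irrefl)
  then show ?thesis using card_nbrs assms by simp
qed

section \<open>Boundaries of three vertices\<close>

lemma card_Un3:
  assumes "finite A" "finite B" "finite C"
  shows "card A + card B + card C + card (A \<inter> B \<inter> C) =
    card (A \<union> B \<union> C) + card (A \<inter> B) + card (A \<inter> C) + card (B \<inter> C)"
proof -
  have "card A + card B = card (A \<union> B) + card (A \<inter> B)"
    using assms by (intro card_Un_Int)
  moreover have "card (A \<union> B) + card C = card (A \<union> B \<union> C) + card ((A \<union> B) \<inter> C)"
    using assms by (intro card_Un_Int) auto
  moreover have "card (A \<inter> C) + card (B \<inter> C) = card ((A \<union> B) \<inter> C) + card (A \<inter> B \<inter> C)"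
    using card_Un_Int[of "A \<inter> C" "B \<inter> C"] assms by (simp add: Int_Un_distrib2) (simp add: Int_ac)
  ultimately show ?thesis by linarith
qed

text \<open>Three pairs with at most four common neighbours each give 12, so one has to be saved.
  \<open>Y\<close> and \<open>Z\<close> differ by the interval \<open>{Suc i..j}\<close>, which has
  at most two splittings unless \<open>j = i + 2\<close>. In that case the prefix
  \<open>{1..Suc i}\<close> leads from \<open>X\<close> to a vertex adjacent to all three.\<close>

lemma common_nbrs_prefixes:
  assumes X: "X \<in> aq_verts n" and ij: "1 \<le> i" "i < j" "j \<le> n"
    and Y: "Y = sym_diff X {1..i}" and Z: "Z = sym_diff X {1..j}"
  shows "card (nbrs n X \<inter> nbrs n Y) + card (nbrs n X \<inter> nbrs n Z) + card (nbrs n Y \<inter> nbrs n Z)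
    \<le> 11 + card (nbrs n X \<inter> nbrs n Y \<inter> nbrs n Z)"
proof -
  have adj: "aq_adj n X Y" "aq_adj n X Z"
    unfolding Y Z by (rule aq_adjI; use X ij in \<open>fastforce simp: gens_mem\<close>)+
  then have YZ: "Y \<in> aq_verts n" "Z \<in> aq_verts n" "X \<noteq> Y" "X \<noteq> Z"
    by (auto simp: aq_adj_def)
  have d: "sym_diff Y Z = {Suc i..j}"
  proof -
    have "sym_diff Y Z = sym_diff {1..i} {1..j}" unfolding Y Z by blast
    also have "\<dots> = {Suc i..j}" using ij by auto
    finally show ?thesis .
  qed
  moreover have "Suc i \<in> {Suc i..j}" using ij by simp
  ultimately have "Y \<noteq> Z" by blast
  note le = card_common_nbrs_le[OF X YZ(1) YZ(3)] card_common_nbrs_le[OF X YZ(2) YZ(4)]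
    card_common_nbrs_le[OF YZ(1,2) \<open>Y \<noteq> Z\<close>]
  show ?thesis
  proof (cases "j = Suc (Suc i)")
    case False
    then have "card (nbrs n Y \<inter> nbrs n Z) \<le> 2"
      unfolding card_common_nbrs[OF YZ(1,2)] d using ij by (intro card_split_gens_interval) auto
    then show ?thesis using le by linarith
  next
    case True
    define W where "W = sym_diff X {1..Suc i}"
    have "W = sym_diff Y {Suc i}" unfolding W_def Y using ij by auto
    moreover have "W = sym_diff Z {Suc (Suc i)}" unfolding W_def Z True by auto
    moreover have "{Suc i} \<in> gens n" "{Suc (Suc i)} \<in> gens n" "{1..Suc i} \<in> gens n"
      using ij True by (auto simp: gens_mem)
    ultimately have "W \<in> nbrs n X \<inter> nbrs n Y \<inter> nbrs n Z"
      using X YZ W_def unfolding nbrs_def aq_adj_iff by blast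
    then have "card (nbrs n X \<inter> nbrs n Y \<inter> nbrs n Z) > 0"
      by (auto simp: card_gt_0_iff)
    then show ?thesis using le by linarith
  qed
qed

text \<open>\<open>{1}\<close> is filed under the prefixes, so that a singleton has
  \<open>i \<ge> 2\<close>, as \<open>card_split_gens_interval\<close> demands.\<close>

lemma gens_cases:
  assumes "g \<in> gens n"
  obtains i where "2 \<le> i" "i \<le> n" "g = {i}" | i where "1 \<le> i" "i \<le> n" "g = {1..i}"
proof -
  obtain i where i: "1 \<le> i" "i \<le> n" "g = {i} \<or> g = {1..i}" using assms by (auto simp: gens_mem)
  show thesis
  proof (cases "g = {1..i}")
    case False
    then have "i \<noteq> 1" "g = {i}" using i by auto
    then show thesis using that(1)[of i] i by simp
  qed (use i that in blast)
qed

text \<open>If one of the two edges comes from a singleton \<open>{i}\<close> with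
  \<open>i \<ge> 2\<close>, its ends have at most two common neighbours and the sum is at most 10.
  Otherwise both edges come from prefixes.\<close>

lemma common_nbrs_path:
  assumes "aq_adj n X Y" "aq_adj n X Z" "Y \<noteq> Z"
  shows "card (nbrs n X \<inter> nbrs n Y) + card (nbrs n X \<inter> nbrs n Z) + card (nbrs n Y \<inter> nbrs n Z)
    \<le> 11 + card (nbrs n X \<inter> nbrs n Y \<inter> nbrs n Z)"
proof -
  have V: "X \<in> aq_verts n" "Y \<in> aq_verts n" "Z \<in> aq_verts n" "X \<noteq> Y" "X \<noteq> Z"
    using assms by (auto simp: aq_adj_def)
  obtain g where g: "g \<in> gens n" "Y = sym_diff X g" using assms by (auto simp: aq_adj_iff)
  obtain h where h: "h \<in> gens n" "Z = sym_diff X h" using assms by (auto simp: aq_adj_iff)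
  have gh: "sym_diff X Y = g" "sym_diff X Z = h" using g h by auto
  note le = card_common_nbrs_le[OF V(1,2,4)] card_common_nbrs_le[OF V(1,3,5)]
    card_common_nbrs_le[OF V(2,3) assms(3)]
  have small: "card (split_gens n {k}) \<le> 2" if "2 \<le> k" for k
    using card_split_gens_interval[of k k n] that by simp
  from g(1) show ?thesis
  proof (cases rule: gens_cases)
    case (1 i)
    then have "card (nbrs n X \<inter> nbrs n Y) \<le> 2"
      unfolding card_common_nbrs[OF V(1,2)] gh using small by simp
    then show ?thesis using le by linarith
  next
    case i: (2 i)
    from h(1) show ?thesis
    proof (cases rule: gens_cases)
      case (1 j)
      then have "card (nbrs n X \<inter> nbrs n Z) \<le> 2"
        unfolding card_common_nbrs[OF V(1,3)] gh using small by simp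
      then show ?thesis using le by linarith
    next
      case j: (2 j)
      have "i \<noteq> j" using i j g h assms(3) by blast
      then consider "i < j" | "j < i" by linarith
      then show ?thesis
      proof cases
        case 1
        show ?thesis
          by (rule common_nbrs_prefixes[OF V(1) i(1) 1 j(2)]) (use g h i j in simp_all)
      next
        case 2
        have "card (nbrs n X \<inter> nbrs n Z) + card (nbrs n X \<inter> nbrs n Y) + card (nbrs n Z \<inter> nbrs n Y)
          \<le> 11 + card (nbrs n X \<inter> nbrs n Z \<inter> nbrs n Y)"
          by (rule common_nbrs_prefixes[OF V(1) j(1) 2 i(2)]) (use g h i j in simp_all)
        then show ?thesis by (simp add: Int_ac)
      qed
    qed
  qed
qed

text \<open>By inclusion-exclusion the three neighbourhoods cover at least
  \<open>3 * (2 * n - 1) - 11\<close> vertices, of which at most three are \<open>X\<close>,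
  \<open>Y\<close>, \<open>Z\<close> themselves.\<close>

lemma card_bdry_path:
  assumes "aq_adj n X Y" "aq_adj n X Z" "Y \<noteq> Z"
  shows "6 * n \<le> card (bdry n {X, Y, Z}) + 17"
proof -
  have V: "X \<in> aq_verts n" "Y \<in> aq_verts n" "Z \<in> aq_verts n" "X \<noteq> Y" "X \<noteq> Z"
    using assms by (auto simp: aq_adj_def)
  have n: "n \<ge> 1" using assms by (auto simp: aq_adj_iff gens_mem)
  let ?U = "nbrs n X \<union> nbrs n Y \<union> nbrs n Z"
  have "card ?U - card {X, Y, Z} \<le> card (bdry n {X, Y, Z})"
    unfolding bdry_def by (simp only: UN_insert UN_empty Un_empty_right Un_assoc)
      (intro diff_card_le_card_Diff; simp)
  moreover have "card {X, Y, Z} = 3" using V assms by simp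
  ultimately show ?thesis
    using common_nbrs_path[OF assms] card_Un3[of "nbrs n X" "nbrs n Y" "nbrs n Z"]
      card_nbrs[OF n V(1)] card_nbrs[OF n V(2)] card_nbrs[OF n V(3)] n by simp
qed

text \<open>If \<open>A\<close> is not a path, some vertex of \<open>A\<close> has no neighbour in
  \<open>A\<close>. The union of neighbourhoods, of size at least \<open>6 * n - 15\<close>, then
  loses at most two vertices instead of three.\<close>

lemma card_bdry_3:
  assumes "A \<subseteq> aq_verts n" "n \<ge> 1" "card A = 3"
  shows "6 * n \<le> card (bdry n A) + 17"
proof (cases "\<exists>X\<in>A. \<exists>Y\<in>A. \<exists>Z\<in>A. Y \<noteq> Z \<and> aq_adj n X Y \<and> aq_adj n X Z")
  case True
  then obtain X Y Z where *: "X \<in> A" "Y \<in> A" "Z \<in> A" "Y \<noteq> Z" "aq_adj n X Y" "aq_adj n X Z" by blast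
  then have "X \<noteq> Y" "X \<noteq> Z" by (auto simp: aq_adj_irrefl)
  then have "card {X, Y, Z} = card A" using * assms by simp
  then have "A = {X, Y, Z}"
    using * assms card_subset_eq[of A "{X, Y, Z}"] card_ge_0_finite[of A] by simp
  then show ?thesis using card_bdry_path[OF *(5,6,4)] by simp
next
  case False
  let ?U = "\<Union>X\<in>A. nbrs n X"
  have fin: "finite A" using assms by (simp add: card_ge_0_finite)
  have "\<not> A \<subseteq> ?U"
  proof
    assume sub: "A \<subseteq> ?U"
    obtain X Y Z where A: "A = {X, Y, Z}" "X \<noteq> Y" "Y \<noteq> Z" "X \<noteq> Z"
      using assms(3) by (auto simp: card_3_iff)
    have "\<exists>Q\<in>A. aq_adj n P Q" if "P \<in> A" for P
      using sub that aq_adj_sym by (fastforce simp: nbrs_def)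
    moreover have "\<not> aq_adj n P P" for P by (simp add: aq_adj_irrefl)
    ultimately show False using False A aq_adj_sym by (metis insert_iff singletonD)
  qed
  then have "card (?U \<inter> A) < card A"
    using fin by (intro psubset_card_mono) auto
  moreover have "card (bdry n A) = card ?U - card (?U \<inter> A)"
    unfolding bdry_def using fin by (intro card_Diff_subset_Int) auto
  ultimately show ?thesis
    using card_UN_nbrs_ge[OF assms(1,2)] assms(3) by (simp add: algebra_simps)
qed

subsection \<open>Separations\<close>

definition separated :: "nat \<Rightarrow> nat set set \<Rightarrow> nat set set \<Rightarrow> bool" where
  "separated n A B \<longleftrightarrow> A \<subseteq> aq_verts n \<and> B \<subseteq> aq_verts n \<and> A \<inter> B = {} \<and>
     (\<forall>X\<in>A. \<forall>Y\<in>B. \<not> aq_adj n X Y)"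

text \<open>Removing at most \<open>s\<close> vertices leaves all but \<open>r\<close> of the others
  on one side. Sides may be empty or disconnected, so that cutting a separation down to a half of
  the cube gives a separation again.\<close>

definition sep_bound :: "nat \<Rightarrow> nat \<Rightarrow> nat \<Rightarrow> bool" where
  "sep_bound n s r \<longleftrightarrow> (\<forall>A B. separated n A B \<and> card (aq_verts n - A - B) \<le> s \<longrightarrow>
     card A \<le> r \<or> card B \<le> r)"

lemma separated_sym: "separated n A B \<longleftrightarrow> separated n B A"
  unfolding separated_def using aq_adj_sym by blast

lemma card_aq_verts: "card (aq_verts n) = 2 ^ n"
  by (simp add: aq_verts_def card_Pow)

lemma card_separated:
  assumes "separated n A B"
  shows "card A + card B + card (aq_verts n - A - B) = 2 ^ n"
proof -
  have *: "A \<subseteq> aq_verts n" "B \<subseteq> aq_verts n" "A \<inter> B = {}"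
    using assms by (auto simp: separated_def)
  then have fin: "finite A" "finite B" using finite_subset by (metis finite_aq_verts)+
  have "aq_verts n - A - B = aq_verts n - (A \<union> B)" by blast
  then have "card (aq_verts n - A - B) = card (aq_verts n) - card (A \<union> B)"
    using * fin by (simp add: card_Diff_subset)
  moreover have "card (A \<union> B) \<le> card (aq_verts n)" using * by (intro card_mono) auto
  moreover have "card (A \<union> B) = card A + card B" using * fin by (simp add: card_Un_disjoint)
  ultimately show ?thesis by (simp add: card_aq_verts)
qed

lemma sep_bound_mono: "sep_bound n s r \<Longrightarrow> s' \<le> s \<Longrightarrow> sep_bound n s' r"
  unfolding sep_bound_def by (meson order_trans)

lemma card_bdry_separated:
  assumes "separated n A B"
  shows "card (bdry n A) \<le> card (aq_verts n - A - B)"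
  using assms nbrs_subset by (intro card_mono) (auto simp: bdry_def separated_def nbrs_def)

text \<open>The separator contains the boundary of each side, so no side can have a size for which
  the boundary exceeds \<open>s\<close>. This shrinks the coarse remainder \<open>k\<close> left by
  a halving step.\<close>

lemma sep_bound_trim:
  assumes "sep_bound n s k"
    and "\<And>A. A \<subseteq> aq_verts n \<Longrightarrow> r < card A \<Longrightarrow> card A \<le> k \<Longrightarrow> s < card (bdry n A)"
  shows "sep_bound n s r"
proof -
  have small: "card A \<le> r"
    if "separated n A B" "card (aq_verts n - A - B) \<le> s" "card A \<le> k" for A B
  proof (rule ccontr)
    assume "\<not> card A \<le> r"
    then have "s < card (bdry n A)" using assms(2) that by (auto simp: separated_def)
    then show False using card_bdry_separated[OF that(1)] that(2) by simp
  qed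
  show ?thesis
    unfolding sep_bound_def
  proof (intro allI impI, elim conjE)
    fix A B assume *: "separated n A B" "card (aq_verts n - A - B) \<le> s"
    have "aq_verts n - A - B = aq_verts n - B - A" by blast
    then show "card A \<le> r \<or> card B \<le> r"
      using small[of A B] small[of B A] * assms(1) separated_sym[of n A B]
      unfolding sep_bound_def by metis
  qed
qed

section \<open>Halving the cube\<close>

definition upper :: "nat \<Rightarrow> nat set set \<Rightarrow> nat set set" where
  "upper n C = {X \<in> aq_verts n. insert (Suc n) X \<in> C}"

lemma aq_verts_Suc: "aq_verts (Suc n) = aq_verts n \<union> insert (Suc n) ` aq_verts n"
  unfolding aq_verts_def by (simp add: atLeastAtMostSuc_conv Pow_insert)

lemma Suc_notin_aq_verts: "X \<in> aq_verts n \<Longrightarrow> Suc n \<notin> X"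
  by (auto simp: aq_verts_def)

text \<open>\<open>upper\<close> strips \<open>Suc n\<close> from its members, so that both halves
  live in \<open>aq_verts n\<close> and matched vertices coincide.\<close>

lemma card_halves:
  assumes "C \<subseteq> aq_verts (Suc n)"
  shows "card C = card (C \<inter> aq_verts n) + card (upper n C)"
proof -
  have "inj_on (insert (Suc n)) (upper n C)"
    by (rule inj_onI) (metis (no_types, lifting) Suc_notin_aq_verts insert_ident mem_Collect_eq upper_def)
  then have "card (upper n C) = card (insert (Suc n) ` upper n C)" by (simp add: card_image)
  moreover have "C = (C \<inter> aq_verts n) \<union> insert (Suc n) ` upper n C"
    using assms by (auto simp: aq_verts_Suc upper_def)
  moreover have "(C \<inter> aq_verts n) \<inter> insert (Suc n) ` upper n C = {}"
    using Suc_notin_aq_verts by blast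
  moreover have "finite (upper n C)" by (simp add: upper_def)
  ultimately show ?thesis
    using card_Un_disjoint[of "C \<inter> aq_verts n" "insert (Suc n) ` upper n C"] by simp
qed

lemma aq_adj_lower: "aq_adj n X Y \<Longrightarrow> aq_adj (Suc n) X Y"
  unfolding aq_adj_def aq_verts_Suc by (elim conjE disjE bexE) fastforce+

lemma aq_adj_upper:
  assumes "aq_adj n X Y"
  shows "aq_adj (Suc n) (insert (Suc n) X) (insert (Suc n) Y)"
proof -
  obtain g where g: "g \<in> gens n" "Y = sym_diff X g" and X: "X \<in> aq_verts n"
    using assms by (auto simp: aq_adj_iff)
  have "Suc n \<notin> g" "g \<in> gens (Suc n)" using g(1) by (auto simp: gens_mem)
  then have "insert (Suc n) Y = sym_diff (insert (Suc n) X) g" unfolding g(2) by blast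
  then show ?thesis
    using aq_adjI[of "insert (Suc n) X" "Suc n" g] X \<open>g \<in> gens (Suc n)\<close> by (simp add: aq_verts_Suc)
qed

lemma aq_adj_cross:
  assumes "X \<in> aq_verts n"
  shows "aq_adj (Suc n) X (insert (Suc n) X)"
proof -
  have "insert (Suc n) X = sym_diff X {Suc n}" using Suc_notin_aq_verts[OF assms] by blast
  moreover have "{Suc n} \<in> gens (Suc n)" by (auto simp: gens_mem)
  ultimately show ?thesis using aq_adjI[of X "Suc n" "{Suc n}"] assms by (simp add: aq_verts_Suc)
qed

lemma separated_halves:
  assumes "separated (Suc n) A B"
  shows "separated n (A \<inter> aq_verts n) (B \<inter> aq_verts n)"
    and "separated n (upper n A) (upper n B)"
    and "A \<inter> aq_verts n \<inter> upper n B = {}"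
    and "upper n A \<inter> (B \<inter> aq_verts n) = {}"
proof -
  have no: "\<not> aq_adj (Suc n) X Y" "\<not> aq_adj (Suc n) Y X" if "X \<in> A" "Y \<in> B" for X Y
    using assms that aq_adj_sym unfolding separated_def by blast+
  have disj: "A \<inter> B = {}" using assms by (simp add: separated_def)
  show "separated n (A \<inter> aq_verts n) (B \<inter> aq_verts n)"
    unfolding separated_def using no aq_adj_lower disj by blast
  show "separated n (upper n A) (upper n B)"
    unfolding separated_def upper_def using no aq_adj_upper disj by blast
  show "A \<inter> aq_verts n \<inter> upper n B = {}"
    unfolding upper_def using no aq_adj_cross by blast
  show "upper n A \<inter> (B \<inter> aq_verts n) = {}"
    unfolding upper_def using no aq_adj_cross by blast
qed

text \<open>Vertices of \<open>A\<^sub>0\<close> have their cross neighbours outside \<open>B\<^sub>1\<close>,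
  so \<open>A\<^sub>0\<close> cannot be much larger than the separator in the other half.\<close>

lemma half_step:
  assumes 0: "separated n A0 B0" and 1: "separated n A1 B1" and cross: "A0 \<inter> B1 = {}"
    and "sep_bound n s0 r0" "s \<le> s0 + u + 1" "s + r0 + r1 < 2 ^ n"
    and s: "card (aq_verts n - A0 - B0) + card (aq_verts n - A1 - B1) \<le> s"
    and A1: "if card (aq_verts n - A1 - B1) \<le> u then card A1 = 0 else card A1 \<le> r1"
  shows "card A0 + card A1 \<le> max u (r0 + r1)"
proof -
  have "A0 \<subseteq> A1 \<union> (aq_verts n - A1 - B1)" using 0 cross by (auto simp: separated_def)
  moreover have "finite A1" using 1 finite_subset by (metis separated_def finite_aq_verts)
  ultimately have "card A0 \<le> card (A1 \<union> (aq_verts n - A1 - B1))" by (intro card_mono) auto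
  also have "\<dots> \<le> card A1 + card (aq_verts n - A1 - B1)" by (rule card_Un_le)
  finally have A0: "card A0 \<le> card A1 + card (aq_verts n - A1 - B1)" .
  show ?thesis
  proof (cases "card (aq_verts n - A1 - B1) \<le> u")
    case True
    then show ?thesis using A0 A1 by simp
  next
    case False
    \<comment> \<open>The other half uses up at least \<open>u + 1\<close> of the \<open>s\<close>
      separator vertices.\<close>
    then have "card (aq_verts n - A0 - B0) \<le> s0" using s assms(5) by linarith
    then have "card A0 \<le> r0 \<or> card B0 \<le> r0" using assms(4) 0 unfolding sep_bound_def by blast
    \<comment> \<open>Otherwise \<open>A0\<close>, \<open>B0\<close> and the separator would fill
      this half with at most \<open>s + r0 + r1\<close> vertices.\<close>
    moreover have "\<not> card B0 \<le> r0"
      using card_separated[OF 0] A0 A1 False s assms(6) by simp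
    ultimately show ?thesis using A1 False by simp
  qed
qed

text \<open>The half with index 1 holds the smaller share of the separator. Whichever of
  \<open>A1\<close> and \<open>B1\<close> is small there, or empty if the share is at most
  \<open>u\<close>, takes the role of \<open>A1\<close> in \<open>half_step\<close>.\<close>

lemma both_halves_step:
  assumes 0: "separated n A0 B0" and 1: "separated n A1 B1"
    and cross: "A0 \<inter> B1 = {}" "A1 \<inter> B0 = {}"
    and bounds: "sep_bound n s1 r1" "sep_bound n u 0" "sep_bound n s0 r0"
    and num: "s div 2 \<le> s1" "s \<le> s0 + u + 1" "s + r0 + r1 < 2 ^ n"
    and s: "card (aq_verts n - A0 - B0) + card (aq_verts n - A1 - B1) \<le> s"
    and le: "card (aq_verts n - A1 - B1) \<le> card (aq_verts n - A0 - B0)"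
  shows "card A0 + card A1 \<le> max u (r0 + r1) \<or> card B0 + card B1 \<le> max u (r0 + r1)"
proof -
  have comm: "aq_verts n - A - B = aq_verts n - B - A" for A B by blast
  have "card (aq_verts n - A1 - B1) \<le> s1" using s le num(1) by linarith
  then have "card A1 \<le> r1 \<or> card B1 \<le> r1" using bounds(1) 1 unfolding sep_bound_def by blast
  moreover have "card A1 = 0 \<or> card B1 = 0" if "card (aq_verts n - A1 - B1) \<le> u"
    using bounds(2) 1 that unfolding sep_bound_def by (metis le_zero_eq)
  ultimately consider
      "if card (aq_verts n - A1 - B1) \<le> u then card A1 = 0 else card A1 \<le> r1"
    | "if card (aq_verts n - B1 - A1) \<le> u then card B1 = 0 else card B1 \<le> r1"
    using comm[of A1 B1] by (cases "card (aq_verts n - A1 - B1) \<le> u") fastforce+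
  then show ?thesis
  proof cases
    case 1
    then show ?thesis using half_step[OF 0 \<open>separated n A1 B1\<close> cross(1) bounds(3) num(2,3) s] by simp
  next
    case 2
    have "card (aq_verts n - B0 - A0) + card (aq_verts n - B1 - A1) \<le> s"
      using s comm[of A0 B0] comm[of A1 B1] by simp
    moreover have "B0 \<inter> A1 = {}" using cross by blast
    ultimately show ?thesis
      using half_step[of n B0 A0 B1 A1 s0 r0 s u r1] 0 1 bounds(3) num 2 separated_sym by simp
  qed
qed

text \<open>\<open>s1\<close> covers the smaller share of the separator, and \<open>u\<close> is a
  threshold up to which a share separates nothing. A smaller share above \<open>u\<close> leaves at
  most \<open>s0\<close> for the other half. The remainder is \<open>u\<close> in the first case and
  \<open>r0 + r1\<close> in the second.\<close>

lemma sep_bound_Suc: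
  assumes bounds: "sep_bound n s1 r1" "sep_bound n u 0" "sep_bound n s0 r0"
    and num: "s div 2 \<le> s1" "s \<le> s0 + u + 1" "s + r0 + r1 < 2 ^ n"
  shows "sep_bound (Suc n) s (max u (r0 + r1))"
  unfolding sep_bound_def
proof (intro allI impI, elim conjE)
  fix A B assume AB: "separated (Suc n) A B" and s: "card (aq_verts (Suc n) - A - B) \<le> s"
  let ?S = "aq_verts (Suc n) - A - B"
  have "?S \<inter> aq_verts n = aq_verts n - A \<inter> aq_verts n - B \<inter> aq_verts n"
    by (auto simp: aq_verts_Suc)
  moreover have "upper n ?S = aq_verts n - upper n A - upper n B"
    by (auto simp: aq_verts_Suc upper_def)
  ultimately have S: "card (aq_verts n - A \<inter> aq_verts n - B \<inter> aq_verts n) +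
      card (aq_verts n - upper n A - upper n B) \<le> s"
    using s card_halves[of ?S n] by (metis Diff_subset subset_trans)
  have "A \<subseteq> aq_verts (Suc n)" "B \<subseteq> aq_verts (Suc n)" using AB by (auto simp: separated_def)
  note card = card_halves[OF this(1)] card_halves[OF this(2)]
  note halves = separated_halves[OF AB]
  show "card A \<le> max u (r0 + r1) \<or> card B \<le> max u (r0 + r1)"
  proof (cases "card (aq_verts n - upper n A - upper n B) \<le>
      card (aq_verts n - A \<inter> aq_verts n - B \<inter> aq_verts n)")
    case True
    show ?thesis
      unfolding card by (rule both_halves_step[OF halves bounds num S True])
  next
    case False
    have "card (upper n A) + card (A \<inter> aq_verts n) \<le> max u (r0 + r1) \<or>
        card (upper n B) + card (B \<inter> aq_verts n) \<le> max u (r0 + r1)"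
      by (rule both_halves_step[OF halves(2,1,4,3) bounds num]) (use S False in linarith)+
    then show ?thesis unfolding card by (simp only: add.commute)
  qed
qed

section \<open>Induction on the dimension\<close>

lemma sep_bound_dim2: "sep_bound 2 s 0"
proof -
  have V: "aq_verts 2 = {{}, {1}, {2}, {1, 2}}"
    by (auto simp: aq_verts_def atLeastAtMost_insertL[symmetric] numeral_2_eq_2 atLeastAtMostSuc_conv)
  have "{1, 2} = {1..2::nat}" by auto
  then have gens: "{1} \<in> gens 2" "{2} \<in> gens 2" "{1, 2} \<in> gens 2"
    by (force simp: gens_mem)+
  have "sym_diff X Y \<in> gens 2" if "X \<in> aq_verts 2" "Y \<in> aq_verts 2" "X \<noteq> Y" for X Y
    using that gens unfolding V by (auto simp: insert_Diff_if insert_commute)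
  then have complete: "aq_adj 2 X Y" if "X \<in> aq_verts 2" "Y \<in> aq_verts 2" "X \<noteq> Y" for X Y
    using that nbrs_iff[of Y 2 X] unfolding nbrs_def by blast
  \<comment> \<open>\<open>AQ\<^sub>2\<close> is the complete graph on four vertices.\<close>
  have "A = {} \<or> B = {}" if "separated 2 A B" for A B
    using that complete unfolding separated_def by blast
  then show ?thesis unfolding sep_bound_def by fastforce
qed

text \<open>The last three estimates come from subsets of 3, 4 and 5 vertices, whence
  \<open>card A\<close> on the right and the constants \<open>14 = 17 - 3\<close>,
  \<open>28 = 2 * 16 - 4\<close> and \<open>45 = 2 * 25 - 5\<close>.\<close>

lemma card_bdry_lower:
  assumes A: "A \<subseteq> aq_verts n" and n: "n \<ge> 1"
  shows "card A = 1 \<Longrightarrow> card (bdry n A) = 2 * n - 1"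
    and "card A = 2 \<Longrightarrow> 4 * n \<le> card (bdry n A) + 8"
    and "card A \<ge> 3 \<Longrightarrow> 6 * n \<le> card (bdry n A) + card A + 14"
    and "card A \<ge> 4 \<Longrightarrow> 8 * n \<le> card (bdry n A) + card A + 28"
    and "card A \<ge> 5 \<Longrightarrow> 10 * n \<le> card (bdry n A) + card A + 45"
proof -
  show "card (bdry n A) = 2 * n - 1" if "card A = 1"
    using card_bdry_singleton A n that by (auto simp: card_1_singleton_iff)
  show "4 * n \<le> card (bdry n A) + 8" if "card A = 2"
    using card_bdry_ge[OF A n] that by simp
  show "6 * n \<le> card (bdry n A) + card A + 14" if "card A \<ge> 3"
  proof -
    obtain B where "B \<subseteq> A" "card B = 3" using \<open>card A \<ge> 3\<close> by (meson obtain_subset_with_card_n)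
    then show ?thesis
      using card_bdry_3[of B n] card_bdry_mono[of B A n] A n order_trans[of B A "aq_verts n"] by simp
  qed
  show "8 * n \<le> card (bdry n A) + card A + 28" if "card A \<ge> 4"
    using card_bdry_ge_subset[OF A n that] by simp
  show "10 * n \<le> card (bdry n A) + card A + 45" if "card A \<ge> 5"
    using card_bdry_ge_subset[OF A n that] by simp
qed

lemma linear_less_exp: "n \<ge> 4 \<Longrightarrow> 2 * n < 2 ^ n"
  "n \<ge> 6 \<Longrightarrow> 8 * n < 2 ^ n" for n :: nat
  by (induction n rule: nat_induct_at_least; simp)+

text \<open>The pattern \<open>2 * n - 2\<close> starts only here: in dimension 3, four vertices
  separate \<open>{}\<close> and \<open>{1, 2}\<close> from \<open>{1, 3}\<close> and
  \<open>{2, 3}\<close>.\<close>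

lemma sep_bound_dim4: "sep_bound 4 6 0"
proof -
  have "sep_bound (Suc 2) 3 (max 1 (0 + 0))"
    by (rule sep_bound_Suc[of 2 1 0 1 1 0]) (auto intro: sep_bound_dim2)
  then have "sep_bound 3 3 1" by simp
  then have 3: "sep_bound 3 3 0"
  proof (rule sep_bound_trim)
    fix A assume A: "A \<subseteq> aq_verts 3" "0 < card A" "card A \<le> 1"
    then have "card A = 1" by simp
    then show "3 < card (bdry 3 A)" using card_bdry_lower(1)[OF A(1)] by simp
  qed
  have "sep_bound (Suc 3) 6 (max 3 (0 + 0))"
    by (rule sep_bound_Suc[OF 3 3 sep_bound_mono[OF 3, of 2]]) auto
  then have "sep_bound 4 6 3" by simp
  then show ?thesis
  proof (rule sep_bound_trim)
    fix A assume A: "A \<subseteq> aq_verts 4" "0 < card A" "card A \<le> 3"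
    then consider "card A = 1" | "card A = 2" | "card A = 3" by linarith
    then show "6 < card (bdry 4 A)"
      using card_bdry_lower[OF A(1)] by cases auto
  qed
qed

lemma sep_bound_zero:
  assumes "n \<ge> 4"
  shows "sep_bound n (2 * n - 2) 0"
  using assms
proof (induction n rule: nat_induct_at_least)
  case base
  then show ?case using sep_bound_dim4 by simp
next
  case (Suc n)
  \<comment> \<open>\<open>u = 1\<close> suffices, as \<open>2 * n = (2 * n - 2) + 1 + 1\<close>;
    the single vertex left over has degree \<open>2 * n + 1\<close> in the new dimension.\<close>
  have "sep_bound (Suc n) (2 * n) (max 1 (0 + 0))"
    by (rule sep_bound_Suc[OF Suc.IH sep_bound_mono[OF Suc.IH] Suc.IH])
      (use Suc.hyps linear_less_exp(1)[of n] in auto)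
  then have "sep_bound (Suc n) (2 * n) 1" by simp
  then have "sep_bound (Suc n) (2 * n) 0"
  proof (rule sep_bound_trim)
    fix A assume A: "A \<subseteq> aq_verts (Suc n)" "0 < card A" "card A \<le> 1"
    then have "card A = 1" by simp
    then show "2 * n < card (bdry (Suc n) A)" using card_bdry_lower(1)[OF A(1)] by simp
  qed
  then show ?case by simp
qed

lemma sep_bound_zero': "n \<ge> 4 \<Longrightarrow> s \<le> 2 * n - 2 \<Longrightarrow> sep_bound n s 0"
  using sep_bound_zero sep_bound_mono by blast

text \<open>Here \<open>11 = 5 + 5 + 1\<close>. For five vertices the boundary estimates give only
  11, so the trimming waits for dimension 6.\<close>

lemma sep_bound_dim5: "sep_bound 5 11 5"
proof -
  have "sep_bound (Suc 4) 11 (max 5 (0 + 0))"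
    by (rule sep_bound_Suc[of 4 5 0 5 5]) (auto intro: sep_bound_zero')
  then show ?thesis by simp
qed

text \<open>\<open>4 * n - 9\<close> is one less than the boundary estimate \<open>4 * n - 8\<close>
  for two vertices.\<close>

lemma sep_bound_one:
  assumes "n \<ge> 6"
  shows "sep_bound n (4 * n - 9) 1"
  using assms
proof (induction n rule: nat_induct_at_least)
  case base
  have "sep_bound (Suc 5) 15 (max 3 (5 + 0))"
    by (rule sep_bound_Suc[of 5 7 0 3 11 5]) (auto intro: sep_bound_zero' sep_bound_dim5)
  then have "sep_bound 6 15 5" by simp
  then have "sep_bound 6 15 1"
  proof (rule sep_bound_trim)
    fix A assume A: "A \<subseteq> aq_verts 6" "1 < card A" "card A \<le> 5"
    then consider "card A = 2" | "card A = 3" | "card A = 4" | "card A = 5" by linarith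
    then show "15 < card (bdry 6 A)"
      using card_bdry_lower[OF A(1)] by cases auto
  qed
  then show ?case by simp
next
  case (Suc n)
  \<comment> \<open>The growth by four per dimension dictates \<open>u = 3\<close>; the smaller
    share, at most \<open>2 * n - 3\<close>, is in the range of
    \<open>sep_bound_zero'\<close>.\<close>
  have "sep_bound (Suc n) (4 * n - 5) (max 3 (1 + 0))"
    by (rule sep_bound_Suc[of n "2 * n - 3" 0 3 "4 * n - 9" 1])
      (use Suc linear_less_exp(2)[of n] in \<open>auto intro: sep_bound_zero'\<close>)
  then have "sep_bound (Suc n) (4 * n - 5) 3" by simp
  then have "sep_bound (Suc n) (4 * n - 5) 1"
  proof (rule sep_bound_trim)
    fix A assume A: "A \<subseteq> aq_verts (Suc n)" "1 < card A" "card A \<le> 3"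
    then consider "card A = 2" | "card A = 3" by linarith
    then show "4 * n - 5 < card (bdry (Suc n) A)"
      using card_bdry_lower[OF A(1)] Suc.hyps by cases auto
  qed
  then show ?case by simp
qed

lemma sep_bound_one': "n \<ge> 6 \<Longrightarrow> s \<le> 4 * n - 9 \<Longrightarrow> sep_bound n s 1"
  using sep_bound_one sep_bound_mono by blast

text \<open>Below dimension 9 the boundary estimates do not reduce the remainder to two vertices. The separator
  sizes 30, 23, 17, 11 in dimensions 8 to 5 are what the halving step asks for, going down from
  36 in dimension 9.\<close>

lemma sep_bound_dim8: "sep_bound 8 30 7"
proof -
  have "sep_bound (Suc 5) 17 (max 5 (5 + 0))"
    by (rule sep_bound_Suc[of 5 8 0 5 11 5]) (auto intro: sep_bound_zero' sep_bound_dim5)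
  then have 6: "sep_bound 6 17 5" by simp
  have "sep_bound (Suc 6) 23 (max 5 (5 + 1))"
    by (rule sep_bound_Suc[of 6 11 1 5 17 5]) (auto intro: sep_bound_zero' sep_bound_one'[unfolded One_nat_def] 6)
  then have 7: "sep_bound 7 23 6" by simp
  have "sep_bound (Suc 7) 30 (max 6 (6 + 1))"
    by (rule sep_bound_Suc[of 7 15 1 6 23 6]) (auto intro: sep_bound_zero' sep_bound_one'[unfolded One_nat_def] 7)
  then show ?thesis by simp
qed

lemma sep_bound_two:
  assumes "n \<ge> 9"
  shows "sep_bound n (6 * n - 18) 2"
  using assms
proof (induction n rule: nat_induct_at_least)
  case base
  have "sep_bound (Suc 8) 36 (max 5 (7 + 1))"
    by (rule sep_bound_Suc[of 8 18 1 5 30 7]) (auto intro: sep_bound_zero' sep_bound_one'[unfolded One_nat_def]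
        sep_bound_dim8)
  then have "sep_bound 9 36 8" by simp
  then have "sep_bound 9 36 2"
  proof (rule sep_bound_trim)
    fix A assume A: "A \<subseteq> aq_verts 9" "2 < card A" "card A \<le> 8"
    \<comment> \<open>At eight vertices the estimate for \<open>card A \<ge> 5\<close> gives exactly
      37, so a remainder of 8 is just small enough.\<close>
    then consider "card A = 3" | "card A = 4" | "card A \<ge> 5" by linarith
    then show "36 < card (bdry 9 A)"
      using card_bdry_lower[OF A(1)] A(3) by cases auto
  qed
  then show ?case by simp
next
  case (Suc n)
  \<comment> \<open>The growth by six dictates \<open>u = 5\<close>; the smaller share, at most
    \<open>3 * n - 6\<close>, does not exceed \<open>4 * n - 9\<close>, so
    \<open>r1 = 1\<close>.\<close>
  have "sep_bound (Suc n) (6 * n - 12) (max 5 (2 + 1))"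
    by (rule sep_bound_Suc[of n "3 * n - 6" 1 5 "6 * n - 18" 2])
      (use Suc linear_less_exp(2)[of n] in \<open>auto intro: sep_bound_zero' sep_bound_one'[unfolded One_nat_def]\<close>)
  then have "sep_bound (Suc n) (6 * n - 12) 5" by simp
  then have "sep_bound (Suc n) (6 * n - 12) 2"
  proof (rule sep_bound_trim)
    fix A assume A: "A \<subseteq> aq_verts (Suc n)" "2 < card A" "card A \<le> 5"
    then consider "card A = 3" | "card A = 4" | "card A = 5" by linarith
    then show "6 * n - 12 < card (bdry (Suc n) A)"
      using card_bdry_lower[OF A(1)] Suc.hyps by cases auto
  qed
  then show ?case by simp
qed

subsection \<open>Vertex cuts\<close>

lemma reach_in_refl: "x \<in> W \<Longrightarrow> reach_in E W x x"
  by (simp add: reach_in_def)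

lemma reach_in_step: "reach_in E W x y \<Longrightarrow> E y z \<Longrightarrow> z \<in> W \<Longrightarrow> reach_in E W x z"
  unfolding reach_in_def by (auto intro: rtranclp.rtrancl_into_rtrancl)

lemma reach_in_closed:
  assumes "reach_in E W x y" "x \<in> A" "\<And>u v. u \<in> A \<Longrightarrow> v \<in> W \<Longrightarrow> E u v \<Longrightarrow> v \<in> A"
  shows "y \<in> A"
proof -
  have "(\<lambda>u v. u \<in> W \<and> v \<in> W \<and> E u v)\<^sup>*\<^sup>* x y" using assms(1) by (simp add: reach_in_def)
  then show ?thesis by induction (use assms in auto)
qed

text \<open>The component of \<open>x\<close> and the union of all other components form a
  separation. The latter contains the component of \<open>y\<close>, so both sides have more than
  two vertices, against \<open>sep_bound_two\<close>.\<close>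

lemma card_h_vertex_cut:
  assumes "h_vertex_cut (aq_verts n) (aq_adj n) 2 S" "n \<ge> 9"
  shows "6 * n - 17 \<le> card S"
proof (rule ccontr)
  assume "\<not> 6 * n - 17 \<le> card S"
  then have S: "card S \<le> 6 * n - 18" using assms(2) by linarith
  let ?W = "aq_verts n - S"
  let ?R = "reach_in (aq_adj n) ?W"
  obtain x y where xy: "x \<in> ?W" "y \<in> ?W" "\<not> ?R x y" and sub: "S \<subseteq> aq_verts n"
    and comp: "\<forall>C\<in>components_in (aq_adj n) ?W. card C > 2"
    using assms(1) unfolding h_vertex_cut_def by blast
  define A where "A = {z. ?R x z}"
  define B where "B = ?W - A"
  have A_sub: "A \<subseteq> ?W" by (auto simp: A_def reach_in_def)
  have closed: "v \<in> A" if "u \<in> A" "v \<in> ?W" "aq_adj n u v" for u v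
    using that reach_in_step unfolding A_def by fast
  have closed_B: "v \<in> B" if "u \<in> B" "v \<in> ?W" "aq_adj n u v" for u v
    using that closed aq_adj_sym unfolding B_def by blast
  have "y \<in> B" using xy by (simp add: A_def B_def)
  then have "{z. ?R y z} \<subseteq> B" using reach_in_closed[of _ _ y _ B] closed_B by blast
  moreover have "finite B" by (simp add: B_def)
  ultimately have "card {z. ?R y z} \<le> card B" by (intro card_mono)
  moreover have "card {z. ?R y z} > 2" "card A > 2"
    using comp xy unfolding components_in_def A_def by blast+
  ultimately have "card A > 2" "card B > 2" by linarith+
  moreover have "separated n A B"
    unfolding separated_def B_def using A_sub closed by blast
  moreover have "aq_verts n - A - B = S" using A_sub sub unfolding B_def by blast
  ultimately show False
    using sep_bound_two[OF assms(2)] S unfolding sep_bound_def by (metis leD)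
qed

lemma card_Diff_le_of_subset:
  assumes "finite A" "C \<subseteq> A \<inter> B"
  shows "card (A - B) \<le> card A - card C"
proof -
  have "finite C" using assms finite_subset by blast
  then have "card (A - C) = card A - card C" using assms by (intro card_Diff_subset) auto
  moreover have "card (A - B) \<le> card (A - C)" using assms by (intro card_mono) auto
  ultimately show ?thesis by simp
qed

text \<open>\<open>?C\<close> lists four neighbours shared by the first two vertices, and
  \<open>?D\<close> seven neighbours of the third already counted, \<open>4 + 4\<close> with
  \<open>{1, 2, 3}\<close> common to both lists. This leaves
  \<open>3 * (2 * n - 1) - 4 - 7 - 3\<close>.\<close>

lemma card_bdry_path_le:
  assumes "n \<ge> 9"
  shows "card (bdry n {{}, {1, 2}, {1, 2, 3, 4}}) \<le> 6 * n - 17"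
    and "aq_adj n {} {1, 2}" "aq_adj n {} {1, 2, 3, 4}" "{1, 2} \<noteq> {1, 2, 3, 4 :: nat}"
proof -
  let ?X = "{} :: nat set" and ?Y = "{1, 2} :: nat set" and ?Z = "{1, 2, 3, 4} :: nat set"
  have int: "{1, 2} = {1..2::nat}" "{1, 2, 3} = {1..3::nat}" "{1, 2, 3, 4} = {1..4::nat}"
     "{1, 2, 3, 4, 5} = {1..5::nat}" by auto
  have ints: "{1, 2} \<in> gens n" "{1, 2, 3} \<in> gens n" "{1, 2, 3, 4} \<in> gens n" "{1, 2, 3, 4, 5} \<in> gens n"
    unfolding int gens_mem using assms by force+
  have sing: "{1} \<in> gens n" "{2} \<in> gens n" "{3} \<in> gens n" "{4} \<in> gens n" "{5} \<in> gens n"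
    unfolding gens_mem using assms by force+
  have V: "?X \<in> aq_verts n" "?Y \<in> aq_verts n" "?Z \<in> aq_verts n"
    using assms by (auto simp: aq_verts_def)
  show ne: "?Y \<noteq> ?Z" by (simp add: set_eq_iff) presburger
  show adj: "aq_adj n ?X ?Y" "aq_adj n ?X ?Z"
    using V ints nbrs_iff[of _ n ?X] by (simp_all add: nbrs_def)
  let ?C = "{{1}, {2}, {3}, {1, 2, 3}} :: nat set set"
  let ?D = "{{4}, {1, 2, 3}, {5}, {1, 2, 3, 4, 5}, {1, 2, 4}, {}, {3, 4}} :: nat set set"
  have "?C \<subseteq> nbrs n ?Y \<inter> nbrs n ?X"
    using V ints sing by (simp add: nbrs_iff insert_Diff_if insert_commute)
  then have "card (nbrs n ?Y - nbrs n ?X) \<le> card (nbrs n ?Y) - card ?C"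
    by (intro card_Diff_le_of_subset) simp
  moreover have "?D \<subseteq> nbrs n ?Z \<inter> (nbrs n ?X \<union> nbrs n ?Y)"
    using V ints sing by (simp add: nbrs_iff insert_Diff_if insert_commute)
  then have "card (nbrs n ?Z - (nbrs n ?X \<union> nbrs n ?Y)) \<le> card (nbrs n ?Z) - card ?D"
    by (intro card_Diff_le_of_subset) simp
  moreover have "card ?C = 4" by (simp add: card_insert_if)
  \<comment> \<open>Membership of 1, 3, 4 and 5 tells the seven sets apart.\<close>
  moreover have "7 \<le> card ?D"
    using card_image_le[of ?D "\<lambda>V. (1 \<in> V, 3 \<in> V, 4 \<in> V, 5 \<in> V)"] by (simp add: card_insert_if)
  moreover let ?U = "nbrs n ?X \<union> nbrs n ?Y \<union> nbrs n ?Z"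
  have U: "?U = nbrs n ?X \<union> (nbrs n ?Y - nbrs n ?X) \<union> (nbrs n ?Z - (nbrs n ?X \<union> nbrs n ?Y))" by blast
  have "card ?U \<le> card (nbrs n ?X) + card (nbrs n ?Y - nbrs n ?X) + card (nbrs n ?Z - (nbrs n ?X \<union> nbrs n ?Y))"
    by (subst U) (meson add_le_mono1 card_Un_le order_trans)
  ultimately have card_U: "card ?U \<le> 6 * n - 14"
    using card_nbrs[of n, OF _ V(1)] card_nbrs[of n, OF _ V(2)] card_nbrs[of n, OF _ V(3)] assms by simp
  have sub: "{?X, ?Y, ?Z} \<subseteq> ?U"
    using adj aq_adj_sym by (auto simp: nbrs_def)
  have "bdry n {?X, ?Y, ?Z} = ?U - {?X, ?Y, ?Z}"
    unfolding bdry_def by blast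
  then have "card (bdry n {?X, ?Y, ?Z}) = card ?U - card {?X, ?Y, ?Z}"
    using sub by (simp only: card_Diff_subset finite.intros)
  moreover have "card {?X, ?Y, ?Z} = 3" using ne by simp
  ultimately show "card (bdry n {{}, {1, 2}, {1, 2, 3, 4}}) \<le> 6 * n - 17"
    using card_U by simp
qed

text \<open>The path is a component with three vertices. Any other remaining vertex loses at most 12
  of its \<open>2 * n - 1 \<ge> 17\<close> neighbours, so its component is large enough as well, and
  such vertices exist because \<open>6 * n - 14 < 2 ^ n\<close>.\<close>

lemma h_vertex_cut_bdry:
  assumes n: "n \<ge> 9" and adj: "aq_adj n X Y" "aq_adj n X Z" "Y \<noteq> Z"
    and le: "card (bdry n {X, Y, Z}) \<le> 6 * n - 17"
  shows "h_vertex_cut (aq_verts n) (aq_adj n) 2 (bdry n {X, Y, Z})"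
proof -
  let ?A = "{X, Y, Z}"
  let ?S = "bdry n ?A"
  let ?W = "aq_verts n - ?S"
  let ?R = "reach_in (aq_adj n) ?W"
  have V: "X \<in> aq_verts n" "Y \<in> aq_verts n" "Z \<in> aq_verts n" "X \<noteq> Y" "X \<noteq> Z"
    using adj by (auto simp: aq_adj_def)
  have A_sub: "?A \<subseteq> ?W" using V by (auto simp: bdry_def)
  have A3: "card ?A = 3" using V adj by simp
  have closed: "v \<in> ?A" if "u \<in> ?A" "v \<in> ?W" "aq_adj n u v" for u v
    using that by (auto simp: bdry_def nbrs_def)
  have "card (?A \<union> ?S) \<le> 3 + (6 * n - 17)"
    using card_Un_le[of ?A ?S] A3 le by linarith
  also have "\<dots> < card (aq_verts n)"
    using linear_less_exp(2)[of n] n by (simp add: card_aq_verts)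
  finally have "\<not> aq_verts n \<subseteq> ?A \<union> ?S"
    by (metis card_mono finite.emptyI finite.insertI finite_UnI finite_bdry leD)
  then obtain y where y: "y \<in> ?W" "y \<notin> ?A" by blast
  then have disconnected: "\<not> ?R X y"
    using reach_in_closed[of _ _ X y ?A] closed by blast
  have "card {z. ?R x z} > 2" if x: "x \<in> ?W" for x
  proof -
    have fin: "finite {z. ?R x z}"
      by (rule finite_subset[of _ "aq_verts n"]) (auto simp: reach_in_def)
    show ?thesis
    proof (cases "x \<in> ?A")
      case True
      have "?R x X"
        using True reach_in_refl[OF x] reach_in_step aq_adj_sym[OF adj(1)] aq_adj_sym[OF adj(2)] A_sub
        by (metis insert_iff insert_subset singletonD)
      moreover from this have "?R x Y"
        by (rule reach_in_step[where E = "aq_adj n" and y = X and z = Y, OF _ adj(1)]) (use A_sub in blast)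
      moreover from \<open>?R x X\<close> have "?R x Z"
        by (rule reach_in_step[where E = "aq_adj n" and y = X and z = Z, OF _ adj(2)]) (use A_sub in blast)
      ultimately have "?A \<subseteq> {z. ?R x z}" by simp
      then have "card ?A \<le> card {z. ?R x z}" by (rule card_mono[OF fin])
      then show ?thesis using A3 by linarith
    next
      case False
      have xV: "x \<in> aq_verts n" using x by blast
      \<comment> \<open>A deleted neighbour of \<open>x\<close> is a common neighbour of
        \<open>x\<close> and a vertex of the path.\<close>
      have "nbrs n x \<inter> ?S \<subseteq> (nbrs n x \<inter> nbrs n X) \<union> (nbrs n x \<inter> nbrs n Y) \<union> (nbrs n x \<inter> nbrs n Z)"
        by (auto simp: bdry_def)
      then have "card (nbrs n x \<inter> ?S) \<le>
          card ((nbrs n x \<inter> nbrs n X) \<union> (nbrs n x \<inter> nbrs n Y) \<union> (nbrs n x \<inter> nbrs n Z))"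
        by (intro card_mono) auto
      also have "\<dots> \<le> card (nbrs n x \<inter> nbrs n X) + card (nbrs n x \<inter> nbrs n Y) + card (nbrs n x \<inter> nbrs n Z)"
        by (meson add_le_mono1 card_Un_le order_trans)
      also have "\<dots> \<le> 4 + 4 + 4"
        using False V by (intro add_mono card_common_nbrs_le xV) auto
      finally have "card (nbrs n x \<inter> ?S) \<le> 12" by simp
      moreover have "card (nbrs n x - ?S) = card (nbrs n x) - card (nbrs n x \<inter> ?S)"
        by (intro card_Diff_subset_Int) simp
      moreover have "card (nbrs n x) = 2 * n - 1" using n xV by (intro card_nbrs) auto
      ultimately have "card (nbrs n x - ?S) > 2" using n by linarith
      moreover have "nbrs n x - ?S \<subseteq> {z. ?R x z}"
        using reach_in_step[OF reach_in_refl[OF x]] nbrs_subset[of n x] by (auto simp: nbrs_def)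
      ultimately show ?thesis using card_mono[OF fin, of "nbrs n x - ?S"] by linarith
    qed
  qed
  then show ?thesis
    unfolding h_vertex_cut_def components_in_def
    using bdry_subset disconnected y A_sub by blast
qed

theorem theorem3p1:
  fixes n :: nat
  assumes "n \<ge> 9"
  shows "extra_connectivity (aq_verts n) (aq_adj n) 2 = 6 * n - 17"
  unfolding extra_connectivity_def
proof (rule Least_equality)
  note path = card_bdry_path_le[OF assms]
  \<comment> \<open>Since this boundary is a cut, the lower bound for cuts turns its upper estimate
    into an equality.\<close>
  from h_vertex_cut_bdry[OF assms path(2-4,1)]
  show "\<exists>S. h_vertex_cut (aq_verts n) (aq_adj n) 2 S \<and> card S = 6 * n - 17"
    using card_h_vertex_cut[OF _ assms] path(1) by (metis le_antisym)
next
  show "6 * n - 17 \<le> k" if "\<exists>S. h_vertex_cut (aq_verts n) (aq_adj n) 2 S \<and> card S = k" for k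
    using that card_h_vertex_cut[OF _ assms] by blast
qed

end
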